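(* Let $0<k_1<k_2$ be commensurable, with $k_2/k_1=p_2/p_1$, $p_1,p_2$ relatively prime odd positive integers, and let $\lambda=p_1/k_1=p_2/k_2$. In the case of $F^+$ assume that $p_1+p_2\in4\mathbb{N}$, and in the case of $F^-$ assume that $p_2-p_1\in4\mathbb{N}$. Let $x(t)\in\mathbb{C}$ be a smooth curve, defined for $t$ close to $0$ on one side of $0$ (that is, on $(-\delta,0)$ or on $(0,\delta)$ for some $\delta>0$), such that $F^{\pm}(x(t),t)=0$ and $x(t)\neq\frac{\lambda}{2}\pi i$, but $x(t)\to\frac{\lambda}{2}\pi i$ as $t\to0$. Then either $$\lim_{t\to0}\frac{\left(x(t)-\frac{\lambda}{2}\pi i\right)^3}{t}=-12,$$ or $$\lim_{t\to0}\frac{x(t)-\frac{\lambda}{2}\pi i}{t}=k_1^2+k_2^2 .$$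
   Context: $\gamma=\frac{k_2+k_1}{k_2-k_1}$, $f_j(x,t)=\exp(-k_jx+k_j^3t)$ for $j=1,2$, $x\in\mathbb{C}$, $t\in\mathbb{R}$, and $$F^{\pm}=(1\mp f_1f_2)^2+\gamma^2(f_1\pm f_2)^2 .$$ The statement is made separately for $F^+$ and for $F^-$. Here $4\mathbb{N}$ denotes the positive multiples of $4$. *)

theory Defs
  imports "HOL-Analysis.Analysis"
begin

definition gam :: "real \<Rightarrow> real \<Rightarrow> real" where
  "gam k1 k2 = (k2 + k1) / (k2 - k1)"

definition fexp :: "real \<Rightarrow> complex \<Rightarrow> real \<Rightarrow> complex" where
  "fexp k x t = exp (- of_real k * x + of_real (k ^ 3 * t))"

definition Fplus :: "real \<Rightarrow> real \<Rightarrow> complex \<Rightarrow> real \<Rightarrow> complex" where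
  "Fplus k1 k2 x t =
     (1 - fexp k1 x t * fexp k2 x t)\<^sup>2
       + of_real ((gam k1 k2)\<^sup>2) * (fexp k1 x t + fexp k2 x t)\<^sup>2"

definition Fminus :: "real \<Rightarrow> real \<Rightarrow> complex \<Rightarrow> real \<Rightarrow> complex" where
  "Fminus k1 k2 x t =
     (1 + fexp k1 x t * fexp k2 x t)\<^sup>2
       + of_real ((gam k1 k2)\<^sup>2) * (fexp k1 x t - fexp k2 x t)\<^sup>2"

text \<open>
  Positive multiples only, so a truncated natural difference \<open>p2 - p1 = 0\<close> is excluded.
\<close>
definition fourN :: "nat set" where
  "fourN = {4 * m | m. 0 < m}"

text \<open>
  Infinite real differentiability of a curve in the complex plane. This is meant for open
  \<open>S\<close> only: there the iterated derivatives at points of \<open>S\<close> do not depend on the values of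
  the (total) function outside \<open>S\<close>.
\<close>
definition smooth_curve_on :: "real set \<Rightarrow> (real \<Rightarrow> complex) \<Rightarrow> bool" where
  "smooth_curve_on S x \<longleftrightarrow>
     (\<forall>n. ((\<lambda>g t. vector_derivative g (at t)) ^^ n) x differentiable_on S)"

end

theory Submission
  imports Defs
begin

text \<open>
  Put \<open>w = x - x0\<close>. At \<open>x0\<close> the factors \<open>exp (- k\<^sub>j x0)\<close> equal \<open>\<plusminus> \<i>\<close>, and the
  congruence on \<open>p2 \<plusminus> p1\<close> makes them combine so that both \<open>F\<^sup>+\<close> and \<open>F\<^sup>-\<close> turn into
  the same difference of squares. With \<open>K = k1 + k2\<close>, \<open>D = k2 - k1\<close> and
  \<open>u = K/2 (w - (k1\<^sup>2 - k1 k2 + k2\<^sup>2) t)\<close>, \<open>v = D/2 (w - (k1\<^sup>2 + k1 k2 + k2\<^sup>2) t)\<close>,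
  this difference is, up to a nonvanishing factor,
  \<open>(D sinh u + K sinh v) (D sinh u - K sinh v)\<close>.

  So the zero set near \<open>(x0, 0)\<close> is a union of two branches. In the sum the linear terms in \<open>w\<close>
  reinforce each other, and \<open>w \<approx> (k1\<^sup>2 + k2\<^sup>2) t\<close> to first order (lemma \<open>linear_branch_limit\<close>). In the
  difference they cancel; what is left is \<open>K D k1 k2 (t + w\<^sup>3 / 12)\<close> to leading order (lemma
  \<open>cubic_branch_limit\<close>). Both limits are obtained by solving the equation exactly for the
  quotient in question, using \<open>sinh z = z + z\<^sup>3 h(z)\<close> with \<open>h(z) \<rightarrow> 1/6\<close> as \<open>z \<rightarrow> 0\<close>;
  this avoids comparing the sizes of \<open>w\<close> and \<open>t\<close> beforehand.

  A curve cannot jump between the branches: on both of them at once \<open>sinh u = sinh v = 0\<close>, which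
  for small arguments means \<open>u = v = 0\<close> and hence \<open>t = 0\<close>. On a short one-sided interval at \<open>0\<close> the
  two conditions thus cut out disjoint relatively closed sets, and connectedness leaves only one of
  them (lemma \<open>continuous_zero_of_product_selects_factor\<close>).
\<close>

section \<open>The cubic remainder of the hyperbolic sine\<close>

text \<open>The value at \<open>0\<close> is the one that makes the quotient continuous there.\<close>

definition sinh_rem :: "complex \<Rightarrow> complex" where
  "sinh_rem z = (if z = 0 then 1 / 6 else (sinh z - z) / z ^ 3)"

lemma sinh_eq_sinh_rem: "sinh z = z + z ^ 3 * sinh_rem z"
  by (simp add: sinh_rem_def)

text \<open>Averaging the cubic Taylor estimates of \<open>exp z\<close> and \<open>exp (- z)\<close>.\<close>

lemma norm_sinh_minus_cubic_le:
  fixes z :: complex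
  assumes "norm z \<le> 1"
  shows "norm (sinh z - z - z ^ 3 / 6) \<le> exp 1 * norm z ^ 4"
proof -
  have expand: "(\<Sum>k\<le>3. y ^ k / fact k) = 1 + y + y\<^sup>2 / 2 + y ^ 3 / 6" for y :: complex
    by (simp add: eval_nat_numeral)
  have bound: "norm (exp y - (1 + y + y\<^sup>2 / 2 + y ^ 3 / 6)) \<le> exp 1 * norm y ^ 4"
    if "norm y \<le> 1" for y :: complex
  proof -
    have "norm (exp y - (\<Sum>k\<le>3. y ^ k / fact k)) \<le> exp \<bar>Re y\<bar> * norm y ^ Suc 3 / fact 3"
      by (rule Taylor_exp)
    also have "\<dots> \<le> exp \<bar>Re y\<bar> * norm y ^ Suc 3"
      by (simp add: fact_numeral)
    also have "\<dots> \<le> exp 1 * norm y ^ Suc 3"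
      using abs_Re_le_cmod[of y] that by (intro mult_right_mono) auto
    finally show ?thesis
      by (simp add: expand)
  qed
  have "2 * (sinh z - z - z ^ 3 / 6)
      = (exp z - (1 + z + z\<^sup>2 / 2 + z ^ 3 / 6))
        - (exp (- z) - (1 + (- z) + (- z)\<^sup>2 / 2 + (- z) ^ 3 / 6))"
    by (simp add: sinh_field_def field_simps)
  then have "norm (2 * (sinh z - z - z ^ 3 / 6)) \<le> exp 1 * norm z ^ 4 + exp 1 * norm z ^ 4"
    using bound[of z] bound[of "- z"] assms
    by (metis norm_minus_cancel norm_triangle_le_diff add_mono)
  then show ?thesis
    unfolding norm_mult by simp
qed

lemma isCont_sinh_rem: "isCont sinh_rem 0"
proof -
  have "((\<lambda>z. sinh_rem z - 1 / 6) \<longlongrightarrow> 0) (at 0)"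
  proof (rule Lim_null_comparison)
    show "\<forall>\<^sub>F z in at 0. norm (sinh_rem z - 1 / 6) \<le> exp 1 * norm z"
      unfolding eventually_at
    proof (intro exI[of _ 1] conjI ballI impI)
      fix z :: complex
      assume "z \<noteq> 0 \<and> dist z 0 < 1"
      then have z: "z \<noteq> 0" "norm z \<le> 1" by auto
      have "sinh_rem z - 1 / 6 = (sinh z - z - z ^ 3 / 6) / z ^ 3"
        using z by (simp add: sinh_rem_def field_simps)
      then have "norm (sinh_rem z - 1 / 6) = norm (sinh z - z - z ^ 3 / 6) / norm z ^ 3"
        by (simp add: norm_divide norm_power)
      also have "\<dots> \<le> exp 1 * norm z ^ 4 / norm z ^ 3"
        using norm_sinh_minus_cubic_le[OF z(2)] by (simp add: divide_right_mono)
      also have "\<dots> = exp 1 * norm z"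
        using z by (simp add: eval_nat_numeral)
      finally show "norm (sinh_rem z - 1 / 6) \<le> exp 1 * norm z" .
    qed simp
    show "((\<lambda>z. exp 1 * norm z) \<longlongrightarrow> 0) (at (0 :: complex))"
      by (auto intro!: tendsto_eq_intros)
  qed
  then have "(sinh_rem \<longlongrightarrow> 1 / 6) (at 0)"
    by (simp add: LIM_zero_iff)
  then show ?thesis
    by (simp add: isCont_def sinh_rem_def)
qed

lemma tendsto_sinh_rem:
  assumes "(u \<longlongrightarrow> 0) F"
  shows "((\<lambda>t. sinh_rem (u t)) \<longlongrightarrow> 1 / 6) F"
  using isCont_tendsto_compose[OF isCont_sinh_rem assms] by (simp add: sinh_rem_def)

text \<open>Zero is an isolated zero of \<open>sinh\<close>.\<close>

lemma eventually_sinh_zero_imp_zero: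
  fixes u :: "'a \<Rightarrow> complex"
  assumes "(u \<longlongrightarrow> 0) F"
  shows "\<forall>\<^sub>F t in F. sinh (u t) = 0 \<longrightarrow> u t = 0"
proof -
  have "((\<lambda>t. 1 + u t ^ 2 * sinh_rem (u t)) \<longlongrightarrow> 1) F"
    using assms tendsto_sinh_rem[OF assms] by (auto intro!: tendsto_eq_intros)
  then have "\<forall>\<^sub>F t in F. 1 + u t ^ 2 * sinh_rem (u t) \<noteq> 0"
    by (rule tendsto_imp_eventually_ne) simp
  then show ?thesis
  proof eventually_elim
    case (elim t)
    have "sinh (u t) = u t * (1 + u t ^ 2 * sinh_rem (u t))"
      by (subst sinh_eq_sinh_rem) (simp add: algebra_simps eval_nat_numeral)
    with elim show ?case by simp
  qed
qed

section \<open>The two branches\<close>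

text \<open>
  The linear part of the equation is \<open>D K (w - (p + q)/2 \<tau>)\<close>. Since the cubic remainders carry factors
  \<open>u\<^sup>2\<close>, \<open>v\<^sup>2\<close> that tend to \<open>0\<close>, the quotient \<open>\<rho> = w/\<tau> - (p + q)/2\<close> satisfies a linear equation
  \<open>\<rho> (1 + A + B) = c (B - A)\<close> whose coefficients \<open>A\<close>, \<open>B\<close> tend to \<open>0\<close>.
\<close>

lemma linear_branch_limit:
  fixes w \<tau> :: "'a \<Rightarrow> complex" and D K p q :: complex
  assumes w: "(w \<longlongrightarrow> 0) F" and \<tau>: "(\<tau> \<longlongrightarrow> 0) F" and \<tau>_nz: "\<forall>\<^sub>F t in F. \<tau> t \<noteq> 0"
    and D: "D \<noteq> 0" and K: "K \<noteq> 0"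
    and eq: "\<forall>\<^sub>F t in F. D * sinh (K / 2 * (w t - q * \<tau> t)) + K * sinh (D / 2 * (w t - p * \<tau> t)) = 0"
  shows "((\<lambda>t. w t / \<tau> t) \<longlongrightarrow> (p + q) / 2) F"
proof -
  define u where "u t = K / 2 * (w t - q * \<tau> t)" for t
  define v where "v t = D / 2 * (w t - p * \<tau> t)" for t
  define A where "A t = u t ^ 2 * sinh_rem (u t) / 2" for t
  define B where "B t = v t ^ 2 * sinh_rem (v t) / 2" for t
  define c where "c = (p - q) / 2"
  have u: "(u \<longlongrightarrow> 0) F" and v: "(v \<longlongrightarrow> 0) F"
    unfolding u_def v_def using w \<tau> by (auto intro!: tendsto_eq_intros)
  have A: "(A \<longlongrightarrow> 0) F" and B: "(B \<longlongrightarrow> 0) F"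
    unfolding A_def B_def using u v tendsto_sinh_rem[OF u] tendsto_sinh_rem[OF v]
    by (auto intro!: tendsto_eq_intros)
  have AB: "((\<lambda>t. 1 + A t + B t) \<longlongrightarrow> 1) F"
    using A B by (auto intro!: tendsto_eq_intros)
  then have "\<forall>\<^sub>F t in F. 1 + A t + B t \<noteq> 0"
    by (rule tendsto_imp_eventually_ne) simp
  with \<tau>_nz eq have "\<forall>\<^sub>F t in F. (p + q) / 2 + c * (B t - A t) / (1 + A t + B t) = w t / \<tau> t"
  proof eventually_elim
    case (elim t)
    define r where "r = w t - (p + q) / 2 * \<tau> t"
    have ur: "u t = K / 2 * (r + c * \<tau> t)" and vr: "v t = D / 2 * (r - c * \<tau> t)"
      by (simp_all add: u_def v_def r_def c_def field_simps)
    have su: "D * sinh (u t) = D * K * ((r + c * \<tau> t) / 2 + A t * (r + c * \<tau> t))"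
      unfolding sinh_eq_sinh_rem[of "u t"] A_def
      by (simp add: ur power3_eq_cube power2_eq_square field_simps)
    have sv: "K * sinh (v t) = D * K * ((r - c * \<tau> t) / 2 + B t * (r - c * \<tau> t))"
      unfolding sinh_eq_sinh_rem[of "v t"] B_def
      by (simp add: vr power3_eq_cube power2_eq_square field_simps)
    have "D * K * (r * (1 + A t + B t) - c * (B t - A t) * \<tau> t)
        = D * sinh (u t) + K * sinh (v t)"
      unfolding su sv by (simp add: field_simps)
    then have "D * K * (r * (1 + A t + B t) - c * (B t - A t) * \<tau> t) = 0"
      using elim(2) unfolding u_def[symmetric] v_def[symmetric] by (simp only:)
    then have "r * (1 + A t + B t) = c * (B t - A t) * \<tau> t"
      using D K by simp
    then have "r / \<tau> t = c * (B t - A t) / (1 + A t + B t)"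
      using elim(1,3) by (simp add: frac_eq_eq)
    moreover have "w t / \<tau> t = (p + q) / 2 + r / \<tau> t"
      using elim(1) by (simp add: r_def diff_divide_distrib)
    ultimately show ?case by simp
  qed
  moreover have "((\<lambda>t. (p + q) / 2 + c * (B t - A t) / (1 + A t + B t)) \<longlongrightarrow> (p + q) / 2) F"
    using A B AB by (auto intro!: tendsto_eq_intros)
  ultimately show ?thesis
    by (rule Lim_transform_eventually[rotated])
qed

text \<open>
  The linear terms in \<open>w\<close> cancel, leaving a multiple of \<open>\<tau>\<close>. In the expanded cubic terms everything but \<open>w\<^sup>3\<close> is
  \<open>\<tau>\<close> times a null function, so the equation reads \<open>w\<^sup>3 b = - \<tau> a\<close> with convergent coefficients.
\<close>

lemma cubic_branch_limit:
  fixes w \<tau> :: "'a \<Rightarrow> complex" and D K p q :: complex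
  assumes w: "(w \<longlongrightarrow> 0) F" and \<tau>: "(\<tau> \<longlongrightarrow> 0) F" and \<tau>_nz: "\<forall>\<^sub>F t in F. \<tau> t \<noteq> 0"
    and D: "D \<noteq> 0" and K: "K \<noteq> 0" and KD: "K\<^sup>2 \<noteq> D\<^sup>2"
    and eq: "\<forall>\<^sub>F t in F. D * sinh (K / 2 * (w t - q * \<tau> t)) - K * sinh (D / 2 * (w t - p * \<tau> t)) = 0"
  shows "((\<lambda>t. w t ^ 3 / \<tau> t) \<longlongrightarrow> - 24 * (p - q) / (K\<^sup>2 - D\<^sup>2)) F"
proof -
  define u where "u t = K / 2 * (w t - q * \<tau> t)" for t
  define v where "v t = D / 2 * (w t - p * \<tau> t)" for t
  define e where "e s t = 3 * w t ^ 2 * s - 3 * w t * s ^ 2 * \<tau> t + s ^ 3 * \<tau> t ^ 2" for s t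
  define a where "a t = (p - q) / 2 - K\<^sup>2 / 8 * sinh_rem (u t) * e q t
    + D\<^sup>2 / 8 * sinh_rem (v t) * e p t" for t
  define b where "b t = (K\<^sup>2 * sinh_rem (u t) - D\<^sup>2 * sinh_rem (v t)) / 8" for t
  have u: "(u \<longlongrightarrow> 0) F" and v: "(v \<longlongrightarrow> 0) F"
    unfolding u_def v_def using w \<tau> by (auto intro!: tendsto_eq_intros)
  have e: "(e s \<longlongrightarrow> 0) F" for s
    unfolding e_def using w \<tau> by (auto intro!: tendsto_eq_intros)
  have a: "(a \<longlongrightarrow> (p - q) / 2) F"
    unfolding a_def using e tendsto_sinh_rem[OF u] tendsto_sinh_rem[OF v]
    by (auto intro!: tendsto_eq_intros)
  have b: "(b \<longlongrightarrow> (K\<^sup>2 - D\<^sup>2) / 48) F"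
    unfolding b_def using tendsto_sinh_rem[OF u] tendsto_sinh_rem[OF v]
    by (auto intro!: tendsto_eq_intros simp: field_simps)
  have "\<forall>\<^sub>F t in F. b t \<noteq> 0"
    using b by (rule tendsto_imp_eventually_ne) (use KD in simp)
  with \<tau>_nz eq have "\<forall>\<^sub>F t in F. - a t / b t = w t ^ 3 / \<tau> t"
  proof eventually_elim
    case (elim t)
    have cube: "(w t - s * \<tau> t) ^ 3 = w t ^ 3 - \<tau> t * e s t" for s
      by (simp add: e_def power3_eq_cube power2_eq_square algebra_simps)
    have su: "D * sinh (u t)
        = D * K * ((w t - q * \<tau> t) / 2 + K\<^sup>2 / 8 * (w t - q * \<tau> t) ^ 3 * sinh_rem (u t))"
      unfolding sinh_eq_sinh_rem[of "u t"]
      by (simp add: u_def power3_eq_cube power2_eq_square field_simps)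
    have sv: "K * sinh (v t)
        = D * K * ((w t - p * \<tau> t) / 2 + D\<^sup>2 / 8 * (w t - p * \<tau> t) ^ 3 * sinh_rem (v t))"
      unfolding sinh_eq_sinh_rem[of "v t"]
      by (simp add: v_def power3_eq_cube power2_eq_square field_simps)
    have "D * K * (w t ^ 3 * b t + \<tau> t * a t)
        = D * sinh (u t) - K * sinh (v t)"
      unfolding su sv cube a_def b_def by (simp add: field_simps power2_eq_square)
    then have "w t ^ 3 * b t = - a t * \<tau> t"
      using elim(2) D K unfolding u_def[symmetric] v_def[symmetric]
      by (simp add: eq_neg_iff_add_eq_0 mult.commute)
    then show ?case
      using elim(1,3) by (simp add: field_simps)
  qed
  moreover have "((\<lambda>t. - a t / b t) \<longlongrightarrow> - ((p - q) / 2) / ((K\<^sup>2 - D\<^sup>2) / 48)) F"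
    using a b KD by (intro tendsto_intros) auto
  moreover have "- ((p - q) / 2) / ((K\<^sup>2 - D\<^sup>2) / 48) = - 24 * (p - q) / (K\<^sup>2 - D\<^sup>2)"
    using KD by (simp add: frac_eq_eq del: minus_divide_left) (simp add: field_simps)
  ultimately show ?thesis
    using Lim_transform_eventually by metis
qed

section \<open>Selecting a branch\<close>

lemma continuous_zero_of_product_selects_factor:
  fixes g h :: "'a::topological_space \<Rightarrow> 'b::{t1_space, semiring_no_zero_divisors}"
  assumes "connected S" and "continuous_on S g" and "continuous_on S h"
    and "\<And>t. t \<in> S \<Longrightarrow> g t * h t = 0" and "\<And>t. t \<in> S \<Longrightarrow> \<not> (g t = 0 \<and> h t = 0)"
  shows "(\<forall>t\<in>S. g t = 0) \<or> (\<forall>t\<in>S. h t = 0)"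
proof (rule ccontr)
  assume contra: "\<not> ?thesis"
  let ?A = "{t \<in> S. g t = 0}" and ?B = "{t \<in> S. h t = 0}"
  have "closedin (top_of_set S) ?A" "closedin (top_of_set S) ?B"
    using continuous_closedin_preimage_constant assms(2,3) by blast+
  moreover have "S \<subseteq> ?A \<union> ?B" "?A \<inter> ?B = {}" "?A \<noteq> {}" "?B \<noteq> {}"
    using assms(4,5) contra by fastforce+
  ultimately show False
    using \<open>connected S\<close> unfolding connected_closedin by blast
qed

text \<open>
  For small arguments the two factors vanish together only where \<open>w = q \<tau> = p \<tau>\<close>, which is impossible for \<open>\<tau> \<noteq> 0\<close>;
  hence a continuous curve in the zero set stays on one branch near \<open>0\<close>.
\<close>

lemma two_branch_dichotomy:
  fixes w :: "real \<Rightarrow> complex" and D K p q :: complex and I :: "real set"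
  assumes w: "(w \<longlongrightarrow> 0) (at 0 within I)" and cont: "continuous_on I w"
    and I: "convex I" "0 \<notin> I"
    and D: "D \<noteq> 0" and K: "K \<noteq> 0" and KD: "K\<^sup>2 \<noteq> D\<^sup>2" and pq: "p \<noteq> q"
    and eq: "\<And>t. t \<in> I \<Longrightarrow> (D * sinh (K / 2 * (w t - q * of_real t)))\<^sup>2
      = (K * sinh (D / 2 * (w t - p * of_real t)))\<^sup>2"
  shows "((\<lambda>t. w t ^ 3 / of_real t) \<longlongrightarrow> - 24 * (p - q) / (K\<^sup>2 - D\<^sup>2)) (at 0 within I) \<or>
    ((\<lambda>t. w t / of_real t) \<longlongrightarrow> (p + q) / 2) (at 0 within I)"
proof -
  define u where "u t = K / 2 * (w t - q * of_real t)" for t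
  define v where "v t = D / 2 * (w t - p * of_real t)" for t
  let ?g = "\<lambda>t. D * sinh (u t) + K * sinh (v t)" and ?h = "\<lambda>t. D * sinh (u t) - K * sinh (v t)"
  have \<tau>: "((of_real :: real \<Rightarrow> complex) \<longlongrightarrow> 0) (at 0 within I)"
    by (auto intro!: tendsto_eq_intros)
  have \<tau>_nz: "\<forall>\<^sub>F t in at 0 within I. (of_real t :: complex) \<noteq> 0"
    by (simp add: eventually_at_filter)
  have "(u \<longlongrightarrow> 0) (at 0 within I)" "(v \<longlongrightarrow> 0) (at 0 within I)"
    unfolding u_def v_def using w \<tau> by (auto intro!: tendsto_eq_intros)
  then have "\<forall>\<^sub>F t in at 0 within I. (sinh (u t) = 0 \<longrightarrow> u t = 0) \<and> (sinh (v t) = 0 \<longrightarrow> v t = 0)"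
    by (intro eventually_conj eventually_sinh_zero_imp_zero)
  then obtain d where d: "d > 0"
    and small: "\<And>t. t \<in> I \<Longrightarrow> t \<noteq> 0 \<Longrightarrow> dist t 0 < d \<Longrightarrow>
      (sinh (u t) = 0 \<longrightarrow> u t = 0) \<and> (sinh (v t) = 0 \<longrightarrow> v t = 0)"
    unfolding eventually_at by blast
  define S where "S = I \<inter> ball 0 d"
  have near: "\<forall>\<^sub>F t in at 0 within I. t \<in> S"
    unfolding eventually_at S_def using d by (auto simp: dist_commute)
  have "(\<forall>t\<in>S. ?g t = 0) \<or> (\<forall>t\<in>S. ?h t = 0)"
  proof (rule continuous_zero_of_product_selects_factor)
    show "connected S"
      unfolding S_def using I(1) by (intro convex_connected convex_Int convex_ball)
    have "continuous_on S w"
      using cont continuous_on_subset unfolding S_def by blast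
    then show "continuous_on S ?g" "continuous_on S ?h"
      unfolding u_def v_def sinh_field_def by (auto intro!: continuous_intros)
    fix t assume "t \<in> S"
    then have t: "t \<in> I" "t \<noteq> 0" "dist t 0 < d"
      using I(2) by (auto simp: S_def dist_commute)
    show "?g t * ?h t = 0"
      using eq[OF t(1)] unfolding u_def v_def by (simp add: power2_eq_square algebra_simps)
    show "\<not> (?g t = 0 \<and> ?h t = 0)"
    proof
      assume both: "?g t = 0 \<and> ?h t = 0"
      then have "2 * (D * sinh (u t)) = 0" "2 * (K * sinh (v t)) = 0"
        by algebra+
      then have "u t = 0" "v t = 0"
        using small[OF t] D K by auto
      then have "q * of_real t = p * of_real t"
        using D K by (simp add: u_def v_def)
      then show False
        using pq t(2) by simp
    qed
  qed
  then show ?thesis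
  proof
    assume "\<forall>t\<in>S. ?g t = 0"
    then have "\<forall>\<^sub>F t in at 0 within I. ?g t = 0"
      using near by (auto elim: eventually_mono)
    then show ?thesis
      using linear_branch_limit[OF w \<tau> \<tau>_nz D K] unfolding u_def v_def by blast
  next
    assume "\<forall>t\<in>S. ?h t = 0"
    then have "\<forall>\<^sub>F t in at 0 within I. ?h t = 0"
      using near by (auto elim: eventually_mono)
    then show ?thesis
      using cubic_branch_limit[OF w \<tau> \<tau>_nz D K KD] unfolding u_def v_def by blast
  qed
qed

section \<open>Reduction to hyperbolic sines\<close>

text \<open>
  Taking the midpoint exponential \<open>exp ((a + b) / 2)\<close> out of \<open>1 - exp (a + b)\<close> and of
  \<open>exp a - exp b\<close> leaves a hyperbolic sine in each.
\<close>

lemma exp_difference_of_squares_eq_sinh: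
  fixes a b g :: complex
  shows "(1 - exp a * exp b)\<^sup>2 - g * (exp a - exp b)\<^sup>2
    = 4 * exp (a + b) * ((sinh ((a + b) / 2))\<^sup>2 - g * (sinh ((a - b) / 2))\<^sup>2)"
proof -
  define s d where "s = (a + b) / 2" and "d = (a - b) / 2"
  have ab: "a = s + d" "b = s - d"
    by (simp_all add: s_def d_def field_simps)
  have E: "exp s * exp (- s) = 1" "exp d * exp (- d) = 1"
    by (simp_all flip: exp_add)
  have f1: "1 - exp a * exp b = - 2 * exp s * sinh s"
    using E by (simp add: ab sinh_field_def exp_add exp_diff exp_minus field_simps)
  have f2: "exp a - exp b = 2 * exp s * sinh d"
    by (simp add: ab sinh_field_def exp_add exp_diff exp_minus field_simps)
  have f3: "exp (a + b) = exp s * exp s"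
    by (simp add: ab flip: exp_add)
  show ?thesis
    unfolding s_def[symmetric] d_def[symmetric] f1 f2 f3
    by (simp add: power2_eq_square algebra_simps)
qed

lemma exp_quarter_period_multiple: "exp (- (of_nat (4 * m) * (of_real pi * \<i> / 2))) = 1"
proof -
  have "of_nat (4 * m) * (of_real pi * \<i> / 2) = of_nat m * (2 * of_real pi * \<i>)"
    by simp
  then show ?thesis
    by (simp only: exp_minus exp_of_nat_mult exp_two_pi_i power_one inverse_1)
qed

lemma exp_odd_quarter_period_squared:
  assumes "odd p"
  shows "(exp (- (of_nat p * (of_real pi * \<i> / 2))))\<^sup>2 = -1"
proof -
  obtain n where n: "p = 2 * n + 1"
    using assms by (auto elim: oddE)
  have "2 * - (of_nat p * (of_real pi * \<i> / 2))
      = - (of_nat (4 * n) * (of_real pi * \<i> / 2)) - of_real pi * \<i>"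
    by (simp add: n algebra_simps)
  then have "(exp (- (of_nat p * (of_real pi * \<i> / 2))))\<^sup>2
      = exp (- (of_nat (4 * n) * (of_real pi * \<i> / 2)) - of_real pi * \<i>)"
    by (simp only: flip: exp_double)
  also have "\<dots> = inverse (exp (of_real pi * \<i>))"
    by (simp only: exp_diff exp_quarter_period_multiple inverse_eq_divide)
  finally show ?thesis
    by simp
qed

text \<open>
  The two functions become the same function of \<open>x - x0\<close>: with \<open>e\<^sub>j = exp (- k\<^sub>j x0)\<close>, the
  hypothesis forces \<open>e\<^sub>1 e\<^sub>2 = 1\<close>, \<open>e\<^sub>2 = - e\<^sub>1\<close> for \<open>F\<^sup>+\<close> and \<open>e\<^sub>1 e\<^sub>2 = -1\<close>, \<open>e\<^sub>2 = e\<^sub>1\<close> for \<open>F\<^sup>-\<close>,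
  while \<open>e\<^sub>1\<^sup>2 = -1\<close> in both cases.
\<close>

lemma Fplus_Fminus_at_half_period:
  fixes k1 k2 lam t :: real and p1 p2 :: nat and x x0 :: complex
  assumes odd: "odd p1" and period: "k1 * lam = real p1" "k2 * lam = real p2"
    and x0: "x0 = of_real (lam / 2) * of_real pi * \<i>"
  defines "R \<equiv> (1 - exp (- of_real k1 * (x - x0) + of_real (k1 ^ 3 * t))
                  * exp (- of_real k2 * (x - x0) + of_real (k2 ^ 3 * t)))\<^sup>2
      - of_real ((gam k1 k2)\<^sup>2) * (exp (- of_real k1 * (x - x0) + of_real (k1 ^ 3 * t))
                  - exp (- of_real k2 * (x - x0) + of_real (k2 ^ 3 * t)))\<^sup>2"
  shows "p1 + p2 \<in> fourN \<Longrightarrow> Fplus k1 k2 x t = R"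
    and "p2 - p1 \<in> fourN \<Longrightarrow> Fminus k1 k2 x t = R"
proof -
  define e where "e p = exp (- (of_nat p * (of_real pi * \<i> / 2)))" for p
  define f1 where "f1 = exp (- of_real k1 * (x - x0) + of_real (k1 ^ 3 * t))"
  define f2 where "f2 = exp (- of_real k2 * (x - x0) + of_real (k2 ^ 3 * t))"
  have phase: "fexp k x t = e p * exp (- of_real k * (x - x0) + of_real (k ^ 3 * t))"
    if "k * lam = real p" for k p
  proof -
    have "of_nat p = (of_real k * of_real lam :: complex)"
      using that by (metis of_real_mult of_real_of_nat_eq)
    then show ?thesis
      by (simp add: fexp_def e_def x0 algebra_simps flip: exp_add)
  qed
  have f: "fexp k1 x t = e p1 * f1" "fexp k2 x t = e p2 * f2"
    using phase period by (simp_all add: f1_def f2_def)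
  have sq: "e p1 * e p1 = -1"
    using exp_odd_quarter_period_squared[OF odd] by (simp add: e_def power2_eq_square)
  have add: "e (m + n) = e m * e n" for m n
    by (simp only: e_def of_nat_add distrib_right minus_add_distrib exp_add)
  have four: "e n = 1" if "n \<in> fourN" for n
    using that exp_quarter_period_multiple by (auto simp: fourN_def e_def)
  have R: "R = (1 - f1 * f2)\<^sup>2 - of_real ((gam k1 k2)\<^sup>2) * (f1 - f2)\<^sup>2"
    by (simp add: R_def f1_def f2_def)
  show "Fplus k1 k2 x t = R" if "p1 + p2 \<in> fourN"
  proof -
    have prod: "e p1 * e p2 = 1"
      using four[OF that] by (simp add: add)
    with sq have e2: "e p2 = - e p1"
      by algebra
    have sum: "(e p1 * f1 + e p2 * f2)\<^sup>2 = (e p1 * e p1) * (f1 - f2)\<^sup>2"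
      unfolding e2 by (simp add: power2_eq_square algebra_simps)
    have mixed: "e p1 * f1 * (e p2 * f2) = (e p1 * e p2) * (f1 * f2)"
      by simp
    show ?thesis
      unfolding Fplus_def f R sum mixed prod sq by simp
  qed
  show "Fminus k1 k2 x t = R" if "p2 - p1 \<in> fourN"
  proof -
    \<comment> \<open>Membership in \<open>fourN\<close> rules out a truncated difference.\<close>
    have "p2 = p1 + (p2 - p1)"
      using that by (auto simp: fourN_def)
    then have e2: "e p2 = e p1"
      using add[of p1 "p2 - p1"] four[OF that] by simp
    have diff: "(e p1 * f1 - e p2 * f2)\<^sup>2 = (e p1 * e p1) * (f1 - f2)\<^sup>2"
      unfolding e2 by (simp add: power2_eq_square algebra_simps)
    have mixed: "e p1 * f1 * (e p2 * f2) = (e p1 * e p1) * (f1 * f2)"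
      by (simp add: e2)
    show ?thesis
      unfolding Fminus_def f R diff mixed sq by simp
  qed
qed

text \<open>
  Half the sum and half the difference of the exponents factor as \<open>k1 \<plusminus> k2\<close> times a linear form, because
  \<open>k1\<^sup>3 \<plusminus> k2\<^sup>3 = (k1 \<plusminus> k2) (k1\<^sup>2 \<minusplus> k1 k2 + k2\<^sup>2)\<close>.
  The factor \<open>k2 - k1\<close> on the left-hand side is the cleared denominator of \<open>gam\<close>.
\<close>

lemma zero_iff_sinh_squares_eq:
  fixes k1 k2 t :: real and w :: complex
  assumes "k1 \<noteq> k2"
  shows "(1 - exp (- of_real k1 * w + of_real (k1 ^ 3 * t))
            * exp (- of_real k2 * w + of_real (k2 ^ 3 * t)))\<^sup>2
      - of_real ((gam k1 k2)\<^sup>2) * (exp (- of_real k1 * w + of_real (k1 ^ 3 * t))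
            - exp (- of_real k2 * w + of_real (k2 ^ 3 * t)))\<^sup>2 = 0 \<longleftrightarrow>
    (of_real (k2 - k1)
        * sinh (of_real (k1 + k2) / 2 * (w - of_real (k1\<^sup>2 - k1 * k2 + k2\<^sup>2) * of_real t)))\<^sup>2
    = (of_real (k1 + k2)
        * sinh (of_real (k2 - k1) / 2 * (w - of_real (k1\<^sup>2 + k1 * k2 + k2\<^sup>2) * of_real t)))\<^sup>2"
  (is "?R = 0 \<longleftrightarrow> (of_real ?D * sinh ?u)\<^sup>2 = (of_real ?K * sinh ?v)\<^sup>2")
proof -
  define a where "a = - of_real k1 * w + of_real (k1 ^ 3 * t)"
  define b where "b = - of_real k2 * w + of_real (k2 ^ 3 * t)"
  have s: "(a + b) / 2 = - ?u" and d: "(a - b) / 2 = ?v"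
    by (simp_all add: a_def b_def field_simps power2_eq_square power3_eq_cube)
  have D: "(of_real ?D :: complex) \<noteq> 0"
    using assms by simp
  have gam: "(of_real ((gam k1 k2)\<^sup>2) :: complex) * (of_real ?D)\<^sup>2 = (of_real ?K)\<^sup>2"
    using D by (simp add: gam_def power_divide add.commute)
  have "?R * (of_real ?D)\<^sup>2
      = 4 * exp (a + b) * ((of_real ?D)\<^sup>2 * (sinh ?u)\<^sup>2
          - (of_real ((gam k1 k2)\<^sup>2) * (of_real ?D)\<^sup>2) * (sinh ?v)\<^sup>2)"
    unfolding a_def[symmetric] b_def[symmetric] exp_difference_of_squares_eq_sinh s d
    by (simp only: sinh_minus power2_minus right_diff_distrib ac_simps)
  also have "\<dots> = 4 * exp (a + b) * ((of_real ?D * sinh ?u)\<^sup>2 - (of_real ?K * sinh ?v)\<^sup>2)"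
    unfolding gam by (simp add: power_mult_distrib)
  finally have *: "?R * (of_real ?D)\<^sup>2 = \<dots>" .
  have "?R = 0 \<longleftrightarrow> ?R * (of_real ?D)\<^sup>2 = 0"
    using D by simp
  also have "\<dots> \<longleftrightarrow> (of_real ?D * sinh ?u)\<^sup>2 = (of_real ?K * sinh ?v)\<^sup>2"
    unfolding * by (simp only: mult_eq_0_iff right_minus_eq exp_not_eq_zero numeral_neq_zero simp_thms)
  finally show ?thesis .
qed

section \<open>Asymptotics of the zeros\<close>

theorem theorem5p1:
  fixes k1 k2 lam \<delta> :: real
    and p1 p2 :: nat
    and I :: "real set"
    and x :: "real \<Rightarrow> complex"
    and x0 :: complex
  assumes "0 < k1" and "k1 < k2"
    and "0 < p1" and "0 < p2" and "odd p1" and "odd p2" and "coprime p1 p2"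
    and "k2 / k1 = real p2 / real p1"
    and "lam = real p1 / k1" and "lam = real p2 / k2"
    and "x0 = of_real (lam / 2) * of_real pi * \<i>"
    and "0 < \<delta>" and "I = {-\<delta><..<0} \<or> I = {0<..<\<delta>}"
    and "smooth_curve_on I x"
    and "\<forall>t\<in>I. x t \<noteq> x0"
    and "(x \<longlongrightarrow> x0) (at 0 within I)"
  shows
    "(p1 + p2 \<in> fourN \<and> (\<forall>t\<in>I. Fplus k1 k2 (x t) t = 0) \<longrightarrow>
        ((\<lambda>t. (x t - x0) ^ 3 / of_real t) \<longlongrightarrow> -12) (at 0 within I) \<or>
        ((\<lambda>t. (x t - x0) / of_real t) \<longlongrightarrow> of_real (k1\<^sup>2 + k2\<^sup>2)) (at 0 within I))
     \<and>
     (p2 - p1 \<in> fourN \<and> (\<forall>t\<in>I. Fminus k1 k2 (x t) t = 0) \<longrightarrow>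
        ((\<lambda>t. (x t - x0) ^ 3 / of_real t) \<longlongrightarrow> -12) (at 0 within I) \<or>
        ((\<lambda>t. (x t - x0) / of_real t) \<longlongrightarrow> of_real (k1\<^sup>2 + k2\<^sup>2)) (at 0 within I))"
proof -
  let ?D = "complex_of_real (k2 - k1)" and ?K = "complex_of_real (k1 + k2)"
  let ?p = "complex_of_real (k1\<^sup>2 + k1 * k2 + k2\<^sup>2)"
  let ?q = "complex_of_real (k1\<^sup>2 - k1 * k2 + k2\<^sup>2)"
  define w where "w t = x t - x0" for t
  have period: "k1 * lam = real p1" "k2 * lam = real p2"
    subgoal using assms(1,9) by simp
    subgoal using assms(1,2,10) by simp
    done
  have I: "convex I" "0 \<notin> I"
    using assms(13) by auto
  have w: "(w \<longlongrightarrow> 0) (at 0 within I)"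
    unfolding w_def using assms(16) by (simp add: LIM_zero)
  have "((\<lambda>g t. vector_derivative g (at t)) ^^ 0) x differentiable_on I"
    using assms(14) unfolding smooth_curve_on_def by blast
  then have cont: "continuous_on I w"
    unfolding w_def by (auto intro!: continuous_intros differentiable_imp_continuous_on)
  have D: "?D \<noteq> 0" and K: "?K \<noteq> 0" and pq: "?p \<noteq> ?q"
    using assms(1,2) by (simp_all only: of_real_eq_0_iff of_real_eq_iff) auto
  have KD: "?K\<^sup>2 - ?D\<^sup>2 = of_real (4 * k1 * k2)" and pq': "?p - ?q = of_real (2 * k1 * k2)"
    by (simp_all add: power2_eq_square algebra_simps)
  have KD': "?K\<^sup>2 \<noteq> ?D\<^sup>2"
    using KD assms(1,2) by auto
  have cubic: "- 24 * (?p - ?q) / (?K\<^sup>2 - ?D\<^sup>2) = -12"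
    unfolding KD pq' using assms(1,2) by simp
  have linear: "(?p + ?q) / 2 = of_real (k1\<^sup>2 + k2\<^sup>2)"
    by simp
  have main: "((\<lambda>t. w t ^ 3 / of_real t) \<longlongrightarrow> -12) (at 0 within I) \<or>
      ((\<lambda>t. w t / of_real t) \<longlongrightarrow> of_real (k1\<^sup>2 + k2\<^sup>2)) (at 0 within I)"
    if "\<And>t. t \<in> I \<Longrightarrow> (?D * sinh (?K / 2 * (w t - ?q * of_real t)))\<^sup>2
      = (?K * sinh (?D / 2 * (w t - ?p * of_real t)))\<^sup>2"
    using two_branch_dichotomy[OF w cont I D K KD' pq that] unfolding cubic linear .
  have neq: "k1 \<noteq> k2"
    using assms(2) by simp
  note reduction = Fplus_Fminus_at_half_period[OF assms(5) period assms(11)]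
  show ?thesis
  proof (intro conjI impI; elim conjE)
    assume "p1 + p2 \<in> fourN" "\<forall>t\<in>I. Fplus k1 k2 (x t) t = 0"
    then show "((\<lambda>t. (x t - x0) ^ 3 / of_real t) \<longlongrightarrow> -12) (at 0 within I) \<or>
        ((\<lambda>t. (x t - x0) / of_real t) \<longlongrightarrow> of_real (k1\<^sup>2 + k2\<^sup>2)) (at 0 within I)"
      using main unfolding w_def zero_iff_sinh_squares_eq[OF neq, symmetric]
      by (simp only: reduction(1))
  next
    assume "p2 - p1 \<in> fourN" "\<forall>t\<in>I. Fminus k1 k2 (x t) t = 0"
    then show "((\<lambda>t. (x t - x0) ^ 3 / of_real t) \<longlongrightarrow> -12) (at 0 within I) \<or>
        ((\<lambda>t. (x t - x0) / of_real t) \<longlongrightarrow> of_real (k1\<^sup>2 + k2\<^sup>2)) (at 0 within I)"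
      using main unfolding w_def zero_iff_sinh_squares_eq[OF neq, symmetric]
      by (simp only: reduction(2))
  qed
qed

end
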